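(* Let $n\ge 3$ and $k\ge 1$ be integers, and let $C(n,k)$ be the caterpillar defined in the context. Then $$\mathrm{rn}(C(n,k))=\begin{cases}3k+7, & \text{if } n=3,\\ 4k+9, & \text{if } n=4,\\ \tfrac12(n^2+4nk+2n-2k-1), & \text{if } n>3 \text{ is odd},\\ \tfrac12(n^2+4nk+2n-4k-6), & \text{if } n>4 \text{ is even}.\end{cases}$$ In particular, for $T=C(n,k)$, with order $p$ and diameter $d$, one has $\mathrm{rn}(T)=(p-1)(d+\varepsilon(T))-2L(T)+\varepsilon(T)+\xi(T)$.
   Context: A radio labelling of a graph $G$ is a map $f: V(G)\to\{0,1,2,\ldots\}$ with $|f(u)-f(v)| \ge \mathrm{diam}(G)+1-d(u,v)$ for all distinct $u,v\in V(G)$. Its span is $\max\{|f(u)-f(v)|: u,v\in V(G)\}$, and the radio number $\mathrm{rn}(G)$ is the minimum span of a radio labelling of $G$. For $n\ge3$, $k\ge1$, $C(n,k)$ is the tree obtained from a path (spine) $v_1,v_2,\ldots,v_n$ ($v_i$ adjacent to $v_{i+1}$) by attaching leaves as follows: (i) if $n$ is odd, each of $v_1,v_{(n-1)/2},v_{(n+3)/2},v_n$ has exactly $k$ neighbours of degree one, and all other spine vertices have no neighbour of degree one; (ii) if $n$ is even, each of $v_1,v_{(n-2)/2},v_{(n+4)/2},v_n$ has exactly $k$ neighbours of degree one, and all other spine vertices have no neighbour of degree one. (For $n=3,4$ these four vertices reduce to the two vertices $v_1,v_n$.) It has order $n+2k\min\{2,\lfloor (n-1)/2\rfloor\}$ and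 diameter $n+1$. For a tree $T$ with diameter $d$: $W(T)$ is the set of weight centers, i.e. vertices minimizing $\sum_{u\in V(T)}d(u,v)$ over $v$ (one vertex or two adjacent vertices). Put $\varepsilon(T)=2-|W(T)|$, $L(u)=\min\{d(u,x):x\in W(T)\}$ and $L(T)=\sum_{u\in V(T)} L(u)$. Also $S(T)=\{u:L(u)\ge\lceil d/2\rceil\}$ if $|W(T)|=1$ and $S(T)=\{u:L(u)\ge\lfloor d/2\rfloor\}$ if $|W(T)|=2$. Finally $\xi(T)=\lfloor|S(T)|/2\rfloor$ if $|W(T)|=1$, and $\xi(T)=\max\{0,|S(T)|-2\}$ if $|W(T)|=2$. *)

theory Defs
  imports "Graph_Theory.Pair_Digraph" "Graph_Theory.Shortest_Path"
begin

text \<open>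
  A finite simple undirected graph is an object \<open>G :: 'a pair_pre_digraph\<close> satisfying the
  locale predicate \<open>pair_graph\<close>: each edge is represented by its two opposite arcs, so that
  \<open>pverts G\<close> is $V(G)$ and \<open>parcs G\<close> is the adjacency relation. The notions below are only
  meaningful for non-empty connected \<open>pair_graph\<close>s.
\<close>

definition gdist :: "'a pair_pre_digraph \<Rightarrow> 'a \<Rightarrow> 'a \<Rightarrow> nat" where
  "gdist G u v = Inf (length ` {p. pre_digraph.awalk (with_proj G) u p v})"

text \<open>
  On connected vertices this is the library distance \<open>\<mu>\<close> for unit weights, with values in
  \<open>nat\<close> instead of \<open>ereal\<close>.
\<close>

lemma gdist_eq_mu:
  assumes "pair_wf_digraph G" and "u \<rightarrow>\<^sup>*\<^bsub>with_proj G\<^esub> v"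
  shows "ereal (real (gdist G u v)) = wf_digraph.\<mu> (with_proj G) (\<lambda>_. 1) u v"
proof -
  interpret pair_wf_digraph G by fact
  let ?P = "{p. awalk u p v}"
  have cost: "awalk_cost (\<lambda>_. 1) p = real (length p)" for p
    by (induction p) auto
  have ne: "length ` ?P \<noteq> {}"
    using assms(2) by (auto simp: reachable_awalk)
  then have "gdist G u v \<in> length ` ?P"
    unfolding gdist_def by (rule Inf_nat_def1)
  then obtain p where p: "awalk u p v" "length p = gdist G u v"
    by auto
  have le: "gdist G u v \<le> length q" if "awalk u q v" for q
    unfolding gdist_def using that by (intro cInf_lower) auto
  show ?thesis
    unfolding \<mu>_def cost
    by (rule antisym, rule INF_greatest, use le in simp, rule INF_lower2[of p]) (use p in auto)
qed

definition graph_diameter :: "'a pair_pre_digraph \<Rightarrow> nat" where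
  "graph_diameter G = Max {gdist G u v | u v. u \<in> pverts G \<and> v \<in> pverts G}"

text \<open>
  A labelling is a total function of which only the values on \<open>pverts G\<close> matter. The
  arithmetic is carried out in \<open>int\<close> because subtraction on \<open>nat\<close> truncates.
\<close>

definition radio_labelling :: "'a pair_pre_digraph \<Rightarrow> ('a \<Rightarrow> nat) \<Rightarrow> bool" where
  "radio_labelling G f \<longleftrightarrow> (\<forall>u \<in> pverts G. \<forall>v \<in> pverts G. u \<noteq> v \<longrightarrow>
     \<bar>int (f u) - int (f v)\<bar> \<ge> int (graph_diameter G) + 1 - int (gdist G u v))"

definition labelling_span :: "'a pair_pre_digraph \<Rightarrow> ('a \<Rightarrow> nat) \<Rightarrow> nat" where
  "labelling_span G f =
     Max {nat \<bar>int (f u) - int (f v)\<bar> | u v. u \<in> pverts G \<and> v \<in> pverts G}"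

definition radio_number :: "'a pair_pre_digraph \<Rightarrow> nat" where
  "radio_number G = (LEAST s. \<exists>f. radio_labelling G f \<and> labelling_span G f = s)"

definition weight :: "'a pair_pre_digraph \<Rightarrow> 'a \<Rightarrow> nat" where
  "weight G v = (\<Sum>u \<in> pverts G. gdist G u v)"

definition weight_centers :: "'a pair_pre_digraph \<Rightarrow> 'a set" where
  "weight_centers G = {v \<in> pverts G. \<forall>w \<in> pverts G. weight G v \<le> weight G w}"

definition eps :: "'a pair_pre_digraph \<Rightarrow> int" where
  "eps G = 2 - int (card (weight_centers G))"

definition level :: "'a pair_pre_digraph \<Rightarrow> 'a \<Rightarrow> nat" where
  "level G u = Min {gdist G u x | x. x \<in> weight_centers G}"

definition total_level :: "'a pair_pre_digraph \<Rightarrow> nat" where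
  "total_level G = (\<Sum>u \<in> pverts G. level G u)"

text \<open>
  A tree has one or two weight centers, so the else-branches of the next two definitions are
  the case of exactly two.
\<close>

definition far_vertices :: "'a pair_pre_digraph \<Rightarrow> 'a set" where
  "far_vertices G =
     (if card (weight_centers G) = 1
      then {u \<in> pverts G. int (level G u) \<ge> \<lceil>real (graph_diameter G) / 2\<rceil>}
      else {u \<in> pverts G. int (level G u) \<ge> \<lfloor>real (graph_diameter G) / 2\<rfloor>})"

definition xi :: "'a pair_pre_digraph \<Rightarrow> int" where
  "xi G =
     (if card (weight_centers G) = 1
      then \<lfloor>real (card (far_vertices G)) / 2\<rfloor>
      else max 0 (int (card (far_vertices G)) - 2))"

text \<open>
  In the caterpillar, \<open>Spine i\<close> is $v_i$ and \<open>Leaf i j\<close> is the $j$-th leaf attached to $v_i$.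
\<close>

datatype cat_vertex = Spine nat | Leaf nat nat

text \<open>
  All four quotients are exact. For $n = 3, 4$ the set collapses to $\{1, n\}$.
\<close>

definition leaf_positions :: "nat \<Rightarrow> nat set" where
  "leaf_positions n =
     (if odd n then {1, (n - 1) div 2, (n + 3) div 2, n}
      else {1, (n - 2) div 2, (n + 4) div 2, n})"

definition caterpillar_edges :: "nat \<Rightarrow> nat \<Rightarrow> cat_vertex rel" where
  "caterpillar_edges n k =
     {(Spine i, Spine (i + 1)) | i. 1 \<le> i \<and> i < n} \<union>
     {(Spine i, Leaf i j) | i j. i \<in> leaf_positions n \<and> 1 \<le> j \<and> j \<le> k}"

definition caterpillar :: "nat \<Rightarrow> nat \<Rightarrow> cat_vertex pair_pre_digraph" where
  "caterpillar n k =
     \<lparr> pverts = {Spine i | i. 1 \<le> i \<and> i \<le> n} \<union>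
                {Leaf i j | i j. i \<in> leaf_positions n \<and> 1 \<le> j \<and> j \<le> k},
       parcs = caterpillar_edges n k \<union> (caterpillar_edges n k)\<inverse> \<rparr>"

lemma pair_graph_caterpillar:
  assumes "n \<ge> 3"
  shows "pair_graph (caterpillar n k)"
proof -
  have lp: "leaf_positions n \<subseteq> {1..n}"
    using assms by (auto simp: leaf_positions_def; presburger)
  have wf: "parcs (caterpillar n k) \<subseteq> pverts (caterpillar n k) \<times> pverts (caterpillar n k)"
    using lp by (auto simp: caterpillar_def caterpillar_edges_def)
  have "pverts (caterpillar n k) \<subseteq> Spine ` {1..n} \<union> case_prod Leaf ` ({1..n} \<times> {1..k})"
    using lp by (auto simp: caterpillar_def)
  then have fin: "finite (pverts (caterpillar n k))"
    by (rule finite_subset) auto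
  have "finite (parcs (caterpillar n k))"
    by (rule finite_subset[OF wf]) (use fin in auto)
  moreover have "sym (parcs (caterpillar n k))"
    by (auto simp: caterpillar_def intro: symI)
  moreover have "fst e \<noteq> snd e" if "e \<in> parcs (caterpillar n k)" for e
    using that by (auto simp: caterpillar_def caterpillar_edges_def)
  ultimately show ?thesis
    using wf fin by unfold_locales (auto simp: symmetric_def arcs_ends_conv)
qed

end

theory Submission
  imports Defs
begin

text \<open>
  Lower bound: list the vertices by increasing label. Twice the span is the sum of the first gap,
  the last gap and all two-step differences. Gaps are bounded through $d(u,v) \le L(u) + L(v)$
  (plus one for opposite sides when there are two centers). A two-step difference around a far
  vertex whose neighbours in the list are not centers exceeds the sum of the two gap bounds by at
  least the number of centers, because these neighbours cannot both lie opposite to the far vertex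
  and opposite to each other; this yields the term $\xi$. Upper bound: an order that alternates
  between the two sides and pairs up the far leaves, so that one enlarged gap serves two of them.
\<close>

section \<open>Distances in the caterpillar\<close>

text \<open>Let \<open>w\<close> be the number of centers. Take a window formed by a far vertex and
  its two list neighbours, neither of them a center. Its excess is exactly \<open>w\<close> only if
  the neighbours lie on one side and their paths to the nearest center share a single edge. A leaf
  attached to a neighbour of a center has distance L + L - 2 to every other non-central vertex of
  its side, so it is an ideal list neighbour for a far leaf; hence the orders for n >= 5 put such
  leaves beside the far ones. Beside a center no excess is forced. With two centers, the orders
  place them at the two ends of the list, each beside one far leaf, which leaves |S| - 2 far
  vertices to pay for. With one center the bound on twice the span is odd, and rounding up supplies
  the missing half. For n = 3, 4 the leaf positions coincide in pairs, and the far leaves themselves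
  hang on the neighbours of the centers; these values need orders of their own.\<close>

lemma gdist_eqI:
  fixes \<delta> :: "'a \<Rightarrow> nat"
  assumes "pair_wf_digraph G" and "u \<in> pverts G" and "v \<in> pverts G"
    and zero: "\<delta> v = 0"
    and lipschitz: "\<And>x y. (x, y) \<in> parcs G \<Longrightarrow> \<delta> x \<le> \<delta> y + 1"
    and descent: "\<And>x. x \<in> pverts G \<Longrightarrow> x \<noteq> v \<Longrightarrow> \<exists>y. (x, y) \<in> parcs G \<and> \<delta> x = \<delta> y + 1"
  shows "gdist G u v = \<delta> u"
proof -
  interpret pair_wf_digraph G by fact
  \<comment> \<open>\<open>\<delta>\<close> acts as a potential: it drops by at most one along an
    arc, which bounds every walk from below, and a walk that always descends attains the
    bound.\<close>
  have lower: "\<delta> x \<le> length p" if "awalk x p v" for x p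
    using that
  proof (induction p arbitrary: x)
    case Nil
    then show ?case using zero by (simp add: awalk_Nil_iff)
  next
    case (Cons e p)
    then have "e \<in> parcs G" "fst e = x" and "\<delta> (snd e) \<le> length p"
      by (auto simp: awalk_Cons_iff)
    then show ?case using lipschitz[of x "snd e"] by (cases e) auto
  qed
  have upper: "\<exists>p. awalk x p v \<and> length p = \<delta> x" if "x \<in> pverts G" for x
    using that
  proof (induction "\<delta> x" arbitrary: x)
    case 0
    then have "x = v" using descent[of x] by auto
    then show ?case using 0 assms(3) by (intro exI[of _ "[]"]) (auto simp: awalk_Nil_iff)
  next
    case (Suc a)
    then have "x \<noteq> v" using zero by auto
    with Suc obtain y where y: "(x, y) \<in> parcs G" "\<delta> x = \<delta> y + 1"
      using descent by blast
    then have "y \<in> pverts G" using in_arcsD2 by auto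
    with Suc y obtain p where "awalk y p v" "length p = \<delta> y" by force
    then show ?case using y by (intro exI[of _ "(x, y) # p"]) (auto simp: awalk_Cons_iff)
  qed
  obtain p where "awalk u p v" "length p = \<delta> u" using upper assms(2) by blast
  then show ?thesis
    unfolding gdist_def by (intro cInf_eq_minimum) (auto intro: lower rev_image_eqI)
qed

fun pos :: "cat_vertex \<Rightarrow> nat" where
  "pos (Spine i) = i" | "pos (Leaf i j) = i"

fun height :: "cat_vertex \<Rightarrow> nat" where
  "height (Spine i) = 0" | "height (Leaf i j) = 1"

text \<open>
  Here and in \<open>clevel\<close> below at most one of the two truncated differences is nonzero: their sum is
  an absolute value here, and the distance of a spine position to the nearest center there.
\<close>

definition cdist :: "cat_vertex \<Rightarrow> cat_vertex \<Rightarrow> nat" where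
  "cdist u v = (if u = v then 0 else (pos u - pos v) + (pos v - pos u) + height u + height v)"

lemma cdist_Spine [simp]: "cdist (Spine i) (Spine j) = (i - j) + (j - i)"
  by (auto simp: cdist_def)

lemma cdist_commute: "cdist u v = cdist v u"
  by (auto simp: cdist_def)

lemma leaf_positions_subset: "n \<ge> 3 \<Longrightarrow> leaf_positions n \<subseteq> {1..n}"
  by (auto simp: leaf_positions_def; presburger)

lemma pverts_caterpillar:
  "pverts (caterpillar n k) = Spine ` {1..n} \<union> case_prod Leaf ` (leaf_positions n \<times> {1..k})"
  by (auto simp: caterpillar_def)

lemma parcs_caterpillar:
  "(u, v) \<in> parcs (caterpillar n k) \<longleftrightarrow>
     (\<exists>i. 1 \<le> i \<and> i < n \<and> (u = Spine i \<and> v = Spine (i + 1) \<or> v = Spine i \<and> u = Spine (i + 1))) \<or>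
     (\<exists>i j. i \<in> leaf_positions n \<and> 1 \<le> j \<and> j \<le> k \<and>
        (u = Spine i \<and> v = Leaf i j \<or> v = Spine i \<and> u = Leaf i j))"
  by (auto simp: caterpillar_def caterpillar_edges_def)

lemma gdist_caterpillar:
  assumes "n \<ge> 3" and u: "u \<in> pverts (caterpillar n k)" and v: "v \<in> pverts (caterpillar n k)"
  shows "gdist (caterpillar n k) u v = cdist u v"
proof (rule gdist_eqI[where \<delta> = "\<lambda>x. cdist x v", OF _ u v])
  interpret pair_graph "caterpillar n k" using assms(1) by (rule pair_graph_caterpillar)
  show "pair_wf_digraph (caterpillar n k)" by unfold_locales
  show "cdist v v = 0" by (simp add: cdist_def)
next
  fix x y assume "(x, y) \<in> parcs (caterpillar n k)"
  then show "cdist x v \<le> cdist y v + 1"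
    by (auto simp: parcs_caterpillar cdist_def)
next
  fix x assume x: "x \<in> pverts (caterpillar n k)" "x \<noteq> v"
  show "\<exists>y. (x, y) \<in> parcs (caterpillar n k) \<and> cdist x v = cdist y v + 1"
  proof (cases x)
    case (Leaf i j)
    then show ?thesis using x
      by (intro exI[of _ "Spine i"]) (auto simp: pverts_caterpillar parcs_caterpillar cdist_def)
  next
    case (Spine i)
    consider "pos v < i" | "pos v > i" | "pos v = i" by linarith
    then show ?thesis
    proof cases
      case 1
      then have "1 \<le> pos v" using v leaf_positions_subset[OF assms(1)]
        by (auto simp: pverts_caterpillar)
      with 1 Spine x show ?thesis
        by (intro exI[of _ "Spine (i - 1)"])
           (auto simp: pverts_caterpillar parcs_caterpillar cdist_def intro!: exI[of _ "i - 1"])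
    next
      case 2
      then have "pos v \<le> n" using v leaf_positions_subset[OF assms(1)]
        by (auto simp: pverts_caterpillar)
      with 2 Spine x show ?thesis
        by (intro exI[of _ "Spine (i + 1)"])
           (auto simp: pverts_caterpillar parcs_caterpillar cdist_def)
    next
      \<comment> \<open>Here \<open>v\<close> is a leaf attached to \<open>Spine i\<close>, and the
        descending arc leads to \<open>v\<close> itself.\<close>
      case 3
      then show ?thesis using Spine x v
        by (intro exI[of _ v]) (auto simp: pverts_caterpillar parcs_caterpillar cdist_def)
    qed
  qed
qed

lemma graph_diameter_caterpillar:
  assumes "n \<ge> 3" "k \<ge> 1"
  shows "graph_diameter (caterpillar n k) = n + 1"
  unfolding graph_diameter_def
proof (rule Max_eqI)
  let ?V = "pverts (caterpillar n k)"
  let ?A = "{gdist (caterpillar n k) u v |u v. u \<in> ?V \<and> v \<in> ?V}"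
  interpret pair_graph "caterpillar n k" using assms(1) by (rule pair_graph_caterpillar)
  have "?A = (\<lambda>(u, v). gdist (caterpillar n k) u v) ` (?V \<times> ?V)" by auto
  then show "finite ?A" by simp
  have pos: "pos u \<in> {1..n}" "height u \<le> 1" if "u \<in> ?V" for u
    using that leaf_positions_subset[OF assms(1)] by (auto simp: pverts_caterpillar)
  show "y \<le> n + 1" if y: "y \<in> ?A" for y
  proof -
    obtain u v where uv: "u \<in> ?V" "v \<in> ?V" "y = cdist u v"
      using y by (auto simp: gdist_caterpillar[OF assms(1)])
    then show ?thesis using pos[OF uv(1)] pos[OF uv(2)] by (auto simp: cdist_def)
  qed
  have "Leaf 1 1 \<in> ?V" "Leaf n 1 \<in> ?V"
    using assms by (auto simp: pverts_caterpillar leaf_positions_def image_iff)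
  moreover have "cdist (Leaf 1 1) (Leaf n 1) = n + 1" using assms by (auto simp: cdist_def)
  ultimately show "n + 1 \<in> ?A" using gdist_caterpillar[OF assms(1)] by force
qed

section \<open>The lower bound\<close>

lemma two_step_sum:
  fixes g :: "nat \<Rightarrow> int"
  shows "(\<Sum>i<N. g (i + 2) - g i) = g (N + 1) + g N - g 1 - g 0"
  by (induction N) auto

text \<open>The equation \<open>d = 2 * h + w - 1\<close> merges d = 2h (one center) and d = 2h + 1
  (two centers); in both cases \<open>2 * h + 1\<close> is d + eps. The loss \<open>2 * w\<close>
  counts the list neighbours of centers, at most two for each, and \<open>2 + w\<close> comes from
  the two ends of the list. The bound \<open>D u v \<le> d\<close> makes \<open>f\<close> injective,
  so the list order is strict.\<close>

lemma radio_span_lower_bound: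
  fixes f :: "'a \<Rightarrow> nat" and D :: "'a \<Rightarrow> 'a \<Rightarrow> int" and L :: "'a \<Rightarrow> int" and h w d :: int
    and side :: "'a \<Rightarrow> bool"
  assumes V: "finite V" "card V \<ge> 2"
    and w: "w = int (card {v \<in> V. L v = 0})" "w \<in> {1, 2}"
    and h: "h \<ge> 2" "d = 2 * h + w - 1"
    and L: "\<And>u. u \<in> V \<Longrightarrow> L u \<ge> 0"
    and radio: "\<And>u v. u \<in> V \<Longrightarrow> v \<in> V \<Longrightarrow> u \<noteq> v \<Longrightarrow> \<bar>int (f u) - int (f v)\<bar> \<ge> d + 1 - D u v"
    and D: "\<And>u v. u \<in> V \<Longrightarrow> v \<in> V \<Longrightarrow> u \<noteq> v \<Longrightarrow> D u v \<le> min d (L u + L v + w - 1)"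
    and D_same: "\<And>u v. u \<in> V \<Longrightarrow> v \<in> V \<Longrightarrow> u \<noteq> v \<Longrightarrow> L u > 0 \<Longrightarrow> L v > 0 \<Longrightarrow> side u = side v \<Longrightarrow>
        D u v \<le> L u + L v - 2"
  obtains x y where "x \<in> V" "y \<in> V"
    "2 * (int (f y) - int (f x)) \<ge> 2 * (int (card V) - 1) * (2 * h + 1) - 4 * (\<Sum>v\<in>V. L v)
       + w * (int (card {v \<in> V. L v \<ge> h}) - 2 * w) + 2 + w"
proof -
  have inj: "inj_on f V"
  proof (rule inj_onI, rule ccontr)
    fix u v assume "u \<in> V" "v \<in> V" "f u = f v" "u \<noteq> v"
    then show False using radio[of u v] D[of u v] by simp
  qed
  define N where "N = card V - 2"
  define us where "us = map (inv_into V f) (sorted_list_of_set (f ` V))"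
  define u where "u i = us ! i" for i
  have len: "length us = N + 2"
    using V inj by (simp add: us_def N_def card_image)
  have set_us: "set us = V"
    using V(1) inj by (simp add: us_def)
  have f_us: "map f us = sorted_list_of_set (f ` V)"
    unfolding us_def map_map o_def
    by (rule map_idI) (use V(1) in \<open>auto simp: f_inv_into_f\<close>)
  have mono: "f (u i) < f (u j)" if "i < j" "j < N + 2" for i j
  proof -
    have "sorted_wrt (<) (map f us)" unfolding f_us by simp
    then show ?thesis using that len by (auto simp: sorted_wrt_iff_nth_less u_def)
  qed
  have uV: "u i \<in> V" if "i < N + 2" for i
    using that len set_us by (auto simp: u_def)
  have dist_us: "distinct us"
    using V(1) inj by (simp add: us_def distinct_map inj_on_inv_into)
  have sum_u: "(\<Sum>v\<in>V. g v) = (\<Sum>i<N+2. g (u i))" for g :: "'a \<Rightarrow> int"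
  proof -
    have "bij_betw u {..<N+2} V"
      using bij_betw_nth[OF dist_us, of "{..<N+2}" V] len set_us by (auto simp: u_def[abs_def])
    then show ?thesis by (rule sum.reindex_bij_betw[symmetric])
  qed
  define F where "F i = int (f (u i))" for i
  define l where "l i = L (u i)" for i
  define S where "S i = (if l i \<ge> h then 1 else 0 :: int)" for i
  define C where "C i = (if l i = 0 then 1 else 0 :: int)" for i
  have u_neq: "u i \<noteq> u j" if "i < j" "j < N + 2" for i j
    using mono[OF that] by auto
  have step: "F j - F i \<ge> d + 1 - D (u i) (u j)" if "i < j" "j < N + 2" for i j
    using radio[OF uV uV u_neq[OF that]] mono[OF that] that by (simp add: F_def)
  have l0: "l i \<ge> 0" if "i < N + 2" for i using L uV[OF that] by (simp add: l_def)
  have gap: "F (i + 1) - F i \<ge> 2 * h + 1 - l i - l (i + 1)" if "i < N + 1" for i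
    using step[of i "i + 1"] D[OF uV uV u_neq[of i "i + 1"]] that h(2) by (simp add: l_def)
  \<comment> \<open>\<open>S\<close> marks a far middle entry, \<open>C\<close> a center next to it.
    With the \<open>C\<close> terms subtracted, the claim is just the sum of two gap bounds unless
    the middle entry is far and has no central neighbour.\<close>
  have two_step: "F (i + 2) - F i \<ge> 2 * (2 * h + 1) - 2 * l (i + 1) - l i - l (i + 2)
      + w * (S (i + 1) - C i - C (i + 2))" if "i < N" for i
  proof (cases "l (i + 1) \<ge> h \<and> l i \<noteq> 0 \<and> l (i + 2) \<noteq> 0")
    case True
    have pos: "l (i + 1) > 0" "l i > 0" "l (i + 2) > 0"
      using True l0[of i] l0[of "i + 2"] that h by auto
    have rhs: "w * (S (i + 1) - C i - C (i + 2)) = w" using True by (simp add: S_def C_def)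
    consider "side (u i) = side (u (i + 1))" | "side (u (i + 2)) = side (u (i + 1))"
      | "side (u i) = side (u (i + 2))" by blast
    then show ?thesis
    proof cases
      case 1
      then show ?thesis
        unfolding rhs using step[of i "i + 1"] D_same[OF uV uV u_neq[of i "i + 1"]] that pos gap[of "i + 1"]
          h(2) w(2) by (simp add: l_def)
    next
      case 2
      then show ?thesis
        unfolding rhs using step[of "i + 1" "i + 2"] D_same[OF uV uV u_neq[of "i + 1" "i + 2"]] that pos
          gap[of i] h(2) w(2) by (simp add: l_def)
    next
      \<comment> \<open>The threshold \<open>h\<close> is calibrated for this case: the direct bound
        between the outer entries matches the claim exactly when
        \<open>l (i + 1) = h\<close>.\<close>
      case 3
      then show ?thesis
        unfolding rhs using step[of i "i + 2"] D_same[OF uV uV u_neq[of i "i + 2"]] that pos h(2) w(2) True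
        by (simp add: l_def)
    qed
  next
    case False
    then have "S (i + 1) - C i - C (i + 2) \<le> 0" by (auto simp: S_def C_def)
    then have "w * (S (i + 1) - C i - C (i + 2)) \<le> 0" using w by (auto intro: mult_nonneg_nonpos)
    then show ?thesis using gap[of i] gap[of "i + 1"] that by simp
  qed
  define Lt where "Lt = (\<Sum>v\<in>V. L v)"
  define St where "St = int (card {v \<in> V. L v \<ge> h})"
  have Lt: "Lt = (\<Sum>i<N+2. l i)" unfolding Lt_def l_def by (rule sum_u)
  have count: "int (card {v \<in> V. P v}) = (\<Sum>i<N+2. if P (u i) then 1 else 0)" for P
    using sum_u[of "\<lambda>v. if P v then 1 else 0"] V(1) by (simp add: sum.inter_filter[symmetric])
  have St: "St = (\<Sum>i<N+2. S i)" unfolding St_def count S_def l_def ..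
  have Ct: "w = (\<Sum>i<N+2. C i)" unfolding w(1) count C_def l_def ..
  have first: "(\<Sum>i<N+2. g i) = (\<Sum>i<N. g i) + g N + g (N + 1)" for g :: "nat \<Rightarrow> int"
    by simp
  have middle: "(\<Sum>i<N+2. g i) = g 0 + (\<Sum>i<N. g (i + 1)) + g (N + 1)" for g :: "nat \<Rightarrow> int"
    by (induction N) auto
  have last: "(\<Sum>i<N+2. g i) = g 0 + g 1 + (\<Sum>i<N. g (i + 2))" for g :: "nat \<Rightarrow> int"
    by (induction N) auto
  have "2 * (F (N + 1) - F 0) = (F 1 - F 0) + (\<Sum>i<N. F (i + 2) - F i) + (F (N + 1) - F N)"
    unfolding two_step_sum by simp
  moreover have "(\<Sum>i<N. F (i + 2) - F i) \<ge> (\<Sum>i<N. 2 * (2 * h + 1) - 2 * l (i + 1) - l i - l (i + 2)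
      + w * (S (i + 1) - C i - C (i + 2)))"
    by (rule sum_mono) (use two_step in auto)
  moreover have "(\<Sum>i<N. 2 * (2 * h + 1) - 2 * l (i + 1) - l i - l (i + 2)
      + w * (S (i + 1) - C i - C (i + 2))) =
      2 * N * (2 * h + 1) - 2 * (Lt - l 0 - l (N + 1)) - (Lt - l N - l (N + 1)) - (Lt - l 0 - l 1)
      + w * ((St - S 0 - S (N + 1)) - (w - C N - C (N + 1)) - (w - C 0 - C 1))"
  proof -
    have shifted: "(\<Sum>i<N. l (i + 1)) = Lt - l 0 - l (N + 1)" "(\<Sum>i<N. l i) = Lt - l N - l (N + 1)"
      "(\<Sum>i<N. l (i + 2)) = Lt - l 0 - l 1" "(\<Sum>i<N. S (i + 1)) = St - S 0 - S (N + 1)"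
      "(\<Sum>i<N. C i) = w - C N - C (N + 1)" "(\<Sum>i<N. C (i + 2)) = w - C 0 - C 1"
      using first[of l] middle[of l] last[of l] middle[of S] first[of C] last[of C] Lt St Ct
      by linarith+
    show ?thesis
      unfolding shifted[symmetric]
      by (simp only: sum.distrib sum_subtractf sum_distrib_left[symmetric] sum_constant)
         (simp add: algebra_simps)
  qed
  moreover have "F 1 - F 0 \<ge> 2 * h + 1 - l 0 - l 1" "F (N + 1) - F N \<ge> 2 * h + 1 - l N - l (N + 1)"
    using gap[of 0] gap[of N] by auto
  ultimately have "2 * (F (N + 1) - F 0) \<ge> 2 * (N + 1) * (2 * h + 1) - 4 * Lt + w * (St - 2 * w)
      + (2 * l 0 - w * S 0 + w * C 0) + (2 * l (N + 1) - w * S (N + 1) + w * C (N + 1))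
      + w * C 1 + w * C N"
    by (simp add: algebra_simps)
  moreover have "w * C 1 \<ge> 0" "w * C N \<ge> 0" using w(2) by (auto simp: C_def)
  \<comment> \<open>An end contributes at least \<open>w\<close> if it is a center and at least 2
    otherwise. For \<open>w = 1\<close> two central ends would give only 2; \<open>Ct\<close>
    excludes them, as there is a single center.\<close>
  moreover have "(2 * l 0 - w * S 0 + w * C 0) + (2 * l (N + 1) - w * S (N + 1) + w * C (N + 1)) \<ge> 2 + w"
  proof -
    have "2 * l i - w * S i + w * C i \<ge> (if l i = 0 then w else 2)" if "i < N + 2" for i
      using w(2) h(1) l0[OF that] by (auto simp: S_def C_def)
    from this[of 0] this[of "N + 1"]
    show ?thesis using w(2) C_def Ct middle[of C] sum_nonneg[of "{..<N}" "\<lambda>i. C (i + 1)"]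
      by (auto split: if_splits)
  qed
  ultimately have "2 * (F (N + 1) - F 0) \<ge> 2 * (N + 1) * (2 * h + 1) - 4 * Lt + w * (St - 2 * w) + 2 + w"
    by linarith
  moreover have "int (card V) - 1 = int N + 1" using V(2) by (simp add: N_def)
  ultimately have "2 * (F (N + 1) - F 0) \<ge> 2 * (int (card V) - 1) * (2 * h + 1) - 4 * Lt
      + w * (St - 2 * w) + 2 + w"
    by simp
  then show thesis
    using that[of "u 0" "u (N + 1)"] uV[of 0] uV[of "N + 1"] unfolding F_def Lt_def St_def by simp
qed

section \<open>Labellings from lists of gaps\<close>

text \<open>
  A labelling is encoded as the list of the vertices in increasing order of labels, each paired
  with the difference between the next label and its own one; the last difference is a dummy.
  As three consecutive differences add up to at least \<open>d\<close>, only vertices at most two places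
  apart need attention.
\<close>

fun admissible :: "('a \<Rightarrow> 'a \<Rightarrow> nat) \<Rightarrow> nat \<Rightarrow> ('a \<times> nat) list \<Rightarrow> bool" where
  "admissible D d ((a, g) # (b, g') # (c, g'') # xs) \<longleftrightarrow>
     d + 1 \<le> g + D a b \<and> d + 1 \<le> g + g' + D a c \<and> d \<le> g + g' + g'' \<and>
     admissible D d ((b, g') # (c, g'') # xs)"
| "admissible D d [(a, g), (b, g')] \<longleftrightarrow> d + 1 \<le> g + D a b"
| "admissible D d [p] \<longleftrightarrow> True"
| "admissible D d [] \<longleftrightarrow> True"

fun list_label :: "('a \<times> nat) list \<Rightarrow> 'a \<Rightarrow> nat" where
  "list_label [] v = 0"
| "list_label ((a, g) # xs) v = (if v = a then 0 else g + list_label xs v)"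

lemma list_label_le:
  "v \<in> fst ` set xs \<Longrightarrow> list_label xs v \<le> sum_list (map snd (butlast xs))"
  by (induction xs v rule: list_label.induct) auto

text \<open>Distinct vertices have distance at least 1, so a label difference of \<open>d\<close>
  always suffices. The three-gap condition also involves the dummy of the last entry; the lists
  below set that dummy to the diameter, so it never obstructs.\<close>

lemma admissible_radio:
  fixes D :: "'a \<Rightarrow> 'a \<Rightarrow> nat"
  assumes "admissible D d xs" and "distinct (map fst xs)"
    and "\<And>u v. u \<noteq> v \<Longrightarrow> D u v \<ge> 1" and "\<And>u v. D u v = D v u"
    and "u \<in> fst ` set xs" and "v \<in> fst ` set xs" and "u \<noteq> v"
  shows "\<bar>int (list_label xs u) - int (list_label xs v)\<bar> \<ge> int d + 1 - int (D u v)"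
  using assms
proof (induction D d xs arbitrary: u v rule: admissible.induct)
  case (1 D d a g b g' c g'' xs)
  let ?xs = "(b, g') # (c, g'') # xs"
  have head: "int (list_label ((a, g) # ?xs) x) \<ge> int d + 1 - int (D a x)"
    if "x \<in> fst ` set ?xs" for x
    using "1.prems"(1,2) that "1.prems"(3)[of a x] by auto
  have head': "int (list_label ((a, g) # ?xs) x) \<ge> int d + 1 - int (D x a)"
    if "x \<in> fst ` set ?xs" for x
    using head[OF that] "1.prems"(4)[of a x] by simp
  consider "u = a" | "v = a" | "u \<noteq> a" "v \<noteq> a" by blast
  then show ?case
  proof cases
    case 1
    then show ?thesis using head[of v] "1.prems"(6,7) by auto
  next
    case 2
    then show ?thesis using head'[of u] "1.prems"(5,7) by auto
  next
    case 3
    then have "\<bar>int (list_label ?xs u) - int (list_label ?xs v)\<bar> \<ge> int d + 1 - int (D u v)"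
      using "1.prems"(1,2,5-7) by (intro "1.IH"[OF _ _ "1.prems"(3,4)]) auto
    then show ?thesis using 3 by simp
  qed
next
  case (2 D d a g b g')
  then have "u = a \<and> v = b \<or> u = b \<and> v = a" by auto
  moreover have "a \<noteq> b" "d + 1 \<le> g + D a b" using "2.prems"(1,2) by auto
  ultimately show ?case using "2.prems"(4)[of a b] by auto
next
  case (3 D d p)
  from "3.prems"(5-7) show ?case by simp
next
  case (4 D d)
  from "4.prems"(5) show ?case by simp
qed

lemma radio_number_eqI:
  assumes "finite (pverts G)"
    and lower: "\<And>f. radio_labelling G f \<Longrightarrow> \<exists>x\<in>pverts G. \<exists>y\<in>pverts G. int s \<le> int (f y) - int (f x)"
    and f: "radio_labelling G f" "\<And>v. v \<in> pverts G \<Longrightarrow> f v \<le> s"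
  shows "radio_number G = s"
proof -
  define A where "A f = (\<lambda>(u, v). nat \<bar>int (f u) - int (f v)\<bar>) ` (pverts G \<times> pverts G)"
    for f :: "'a \<Rightarrow> nat"
  have span: "labelling_span G f = Max (A f)" for f
    unfolding labelling_span_def A_def by (rule arg_cong[of _ _ Max]) auto
  have finite: "finite (A f)" for f using assms(1) by (simp add: A_def)
  have ge: "s \<le> labelling_span G f" if "radio_labelling G f" for f
  proof -
    obtain x y where xy: "x \<in> pverts G" "y \<in> pverts G" "int s \<le> int (f y) - int (f x)"
      using lower[OF \<open>radio_labelling G f\<close>] by blast
    then have "nat \<bar>int (f y) - int (f x)\<bar> \<in> A f"
      unfolding A_def by (intro image_eqI[of _ _ "(y, x)"]) auto
    from Max_ge[OF finite this] show ?thesis using xy(3) unfolding span by simp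
  qed
  have "A f \<noteq> {}" using lower[OF f(1)] by (auto simp: A_def)
  moreover have "a \<le> s" if "a \<in> A f" for a
  proof -
    obtain u v where "u \<in> pverts G" "v \<in> pverts G" "a = nat \<bar>int (f u) - int (f v)\<bar>"
      using \<open>a \<in> A f\<close> by (auto simp: A_def)
    then show ?thesis using f(2)[of u] f(2)[of v] by linarith
  qed
  ultimately have "labelling_span G f \<le> s"
    unfolding span using finite by simp
  with ge[OF f(1)] have "labelling_span G f = s" by simp
  then show ?thesis
    unfolding radio_number_def using f(1) ge by (intro Least_equality) auto
qed

section \<open>Weight centers and levels\<close>

lemma in_pverts_caterpillar [simp]:
  "Spine i \<in> pverts (caterpillar n k) \<longleftrightarrow> 1 \<le> i \<and> i \<le> n"
  "Leaf i j \<in> pverts (caterpillar n k) \<longleftrightarrow> i \<in> leaf_positions n \<and> 1 \<le> j \<and> j \<le> k"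
  by (auto simp: pverts_caterpillar)

lemma finite_leaf_positions: "finite (leaf_positions n)"
  by (simp add: leaf_positions_def)

lemma finite_pverts_caterpillar: "finite (pverts (caterpillar n k))"
  by (simp add: pverts_caterpillar finite_leaf_positions)

definition clevel :: "nat \<Rightarrow> cat_vertex \<Rightarrow> nat" where
  "clevel n u = height u + ((n + 1) div 2 - pos u) + (pos u - (n + 2) div 2)"

definition centers :: "nat \<Rightarrow> nat set" where
  "centers n = {(n + 1) div 2, (n + 2) div 2}"

lemma card_centers: "card (centers n) = (if odd n then 1 else 2)"
  by (auto simp: centers_def elim!: oddE evenE)

lemma pos_in_range:
  assumes "n \<ge> 3" "u \<in> pverts (caterpillar n k)"
  shows "1 \<le> pos u" "pos u \<le> n"
  using assms leaf_positions_subset[OF assms(1)] by (auto simp: pverts_caterpillar)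

lemma leaf_positions_odd: "leaf_positions (2 * m + 1) = {1, m, m + 2, 2 * m + 1}"
  by (simp add: leaf_positions_def)

lemma leaf_positions_even: "leaf_positions (2 * m) = {1, m - 1, m + 2, 2 * m}"
proof -
  have "(2 * m - 2) div 2 = m - 1" "(2 * m + 4) div 2 = m + 2" by auto
  then show ?thesis by (simp add: leaf_positions_def)
qed

text \<open>Needed twice: a leaf at the center of an odd spine would be its own mirror image, and
  any leaf at a center would have positive level without lying strictly on one side.\<close>

lemma center_not_leaf_position:
  assumes "n \<ge> 3" "i \<in> leaf_positions n"
  shows "i < (n + 1) div 2 \<or> (n + 2) div 2 < i"
proof (cases "odd n")
  case True
  then obtain m where n: "n = 2 * m + 1" by (rule oddE)
  have "i = 1 \<or> i = m \<or> i = m + 2 \<or> i = 2 * m + 1" and "m \<ge> 1"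
    using assms unfolding n leaf_positions_odd by auto
  then show ?thesis unfolding n leaf_positions_odd by (elim disjE) simp_all
next
  case False
  then obtain m where n: "n = 2 * m" by (auto elim: evenE)
  have "i = 1 \<or> i = m - 1 \<or> i = m + 2 \<or> i = 2 * m" and "m \<ge> 2"
    using assms unfolding n leaf_positions_even by auto
  then show ?thesis unfolding n leaf_positions_even by (elim disjE) simp_all
qed

section \<open>Weight centers by reflecting the spine\<close>

definition mirror :: "nat \<Rightarrow> cat_vertex \<Rightarrow> cat_vertex" where
  "mirror n u = (case u of Spine i \<Rightarrow> Spine (n + 1 - i) | Leaf i j \<Rightarrow> Leaf (n + 1 - i) j)"

lemma leaf_positions_mirror:
  assumes "n \<ge> 3" "i \<in> leaf_positions n"
  shows "n + 1 - i \<in> leaf_positions n"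
proof (cases "odd n")
  case True
  then obtain m where n: "n = 2 * m + 1" by (rule oddE)
  have "i = 1 \<or> i = m \<or> i = m + 2 \<or> i = 2 * m + 1" and "m \<ge> 1"
    using assms unfolding n leaf_positions_odd by auto
  then show ?thesis unfolding n leaf_positions_odd by (elim disjE) simp_all
next
  case False
  then obtain m where n: "n = 2 * m" by (auto elim: evenE)
  have "i = 1 \<or> i = m - 1 \<or> i = m + 2 \<or> i = 2 * m" and "m \<ge> 2"
    using assms unfolding n leaf_positions_even by auto
  then show ?thesis unfolding n leaf_positions_even by (elim disjE) simp_all
qed

lemma mirror_in_pverts:
  assumes "n \<ge> 3" "u \<in> pverts (caterpillar n k)"
  shows "mirror n u \<in> pverts (caterpillar n k)"
  using assms leaf_positions_mirror[OF assms(1)]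
  by (cases u) (auto simp: mirror_def)

lemma mirror_mirror:
  assumes "n \<ge> 3" "u \<in> pverts (caterpillar n k)"
  shows "mirror n (mirror n u) = u"
  using pos_in_range[OF assms] by (cases u) (auto simp: mirror_def)

lemma cdist_triangle: "cdist u v \<le> cdist u w + cdist w v"
  by (auto simp: cdist_def)

text \<open>One of the two copies of the weight is reindexed by the reflection, which is an
  involution on the vertices.\<close>

lemma weight_mirror:
  assumes "n \<ge> 3" "v \<in> pverts (caterpillar n k)"
  shows "2 * weight (caterpillar n k) v =
    (\<Sum>u\<in>pverts (caterpillar n k). cdist u v + cdist v (mirror n u))"
proof -
  let ?V = "pverts (caterpillar n k)"
  have "bij_betw (mirror n) ?V ?V"
    by (rule bij_betw_byWitness[of _ "mirror n"])
       (use mirror_in_pverts[OF assms(1)] mirror_mirror[OF assms(1)] in auto)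
  then have "(\<Sum>u\<in>?V. cdist v (mirror n u)) = (\<Sum>u\<in>?V. cdist v u)"
    by (rule sum.reindex_bij_betw)
  moreover have "weight (caterpillar n k) v = (\<Sum>u\<in>?V. cdist u v)"
    unfolding weight_def using gdist_caterpillar[OF assms(1) _ assms(2)] by simp
  ultimately show ?thesis by (simp add: sum.distrib cdist_commute[of v])
qed

text \<open>By the triangle inequality twice the weight is at least \<open>M\<close>, with equality
  iff \<open>v\<close> lies on the path from \<open>u\<close> to its mirror image for every
  \<open>u\<close>. All these paths contain the centers, and the one starting at a center contains
  nothing else.\<close>

lemma weight_centers_caterpillar:
  assumes "n \<ge> 3"
  shows "weight_centers (caterpillar n k) = Spine ` centers n"
proof -
  let ?V = "pverts (caterpillar n k)" and ?W = "weight (caterpillar n k)"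
  define M where "M = (\<Sum>u\<in>?V. cdist u (mirror n u))"
  have ge: "M \<le> 2 * ?W v" if "v \<in> ?V" for v
    unfolding weight_mirror[OF assms that] M_def by (intro sum_mono cdist_triangle)
  have centers_V: "Spine c \<in> ?V" if "c \<in> centers n" for c
    using that assms by (auto simp: centers_def)
  have eq: "2 * ?W (Spine c) = M" if "c \<in> centers n" for c
    unfolding weight_mirror[OF assms centers_V[OF that]] M_def
  proof (rule sum.cong[OF refl])
    fix u assume u: "u \<in> ?V"
    define c' where "c' = n + 1 - c"
    have c': "c \<le> c' + 1" "c' \<le> c + 1" "n + 1 = c + c'"
      using that unfolding c'_def by (auto simp: centers_def)
    show "cdist u (Spine c) + cdist (Spine c) (mirror n u) = cdist u (mirror n u)"
    proof (cases u)
      case (Spine i)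
      define x where "x = n + 1 - i"
      have "i + x = c + c'" using u c'(3) Spine by (simp add: x_def)
      then have "i \<le> c \<and> c \<le> x \<or> x \<le> c \<and> c \<le> i" using c'(1,2) by linarith
      then have "(i - c) + (c - i) + ((c - x) + (x - c)) = (i - x) + (x - i)" by auto
      then show ?thesis using Spine by (simp add: mirror_def x_def)
    next
      case (Leaf i j)
      then have "1 \<le> i" "i < c + c'" and i: "i < (n + 1) div 2 \<or> (n + 2) div 2 < i"
        using u c' pos_in_range[OF assms u] center_not_leaf_position[OF assms] by auto
      moreover have "i < c \<and> i < c' \<or> c < i \<and> c' < i"
        using i c' that by (auto simp: centers_def)
      ultimately show ?thesis using Leaf c'(1,2)
        unfolding mirror_def c'(3) by (auto simp: cdist_def)
    qed
  qed
  have strict: "M < 2 * ?W v" if v: "v \<in> ?V" "v \<notin> Spine ` centers n" for v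
    unfolding weight_mirror[OF assms v(1)] M_def
  proof (rule sum_strict_mono_ex1[OF finite_pverts_caterpillar])
    show "\<forall>u\<in>?V. cdist u (mirror n u) \<le> cdist u v + cdist v (mirror n u)"
      by (simp add: cdist_triangle)
    define c where "c = (n + 1) div 2"
    define c' where "c' = (n + 2) div 2"
    have c': "n + 1 - c = c'" "c' = c \<or> c' = c + 1" unfolding c_def c'_def by linarith+
    have "Spine c \<in> ?V" by (rule centers_V) (simp add: centers_def c_def)
    moreover have "cdist (Spine c) (mirror n (Spine c)) < cdist (Spine c) v + cdist v (mirror n (Spine c))"
    proof (cases v)
      case (Spine i)
      then have "i \<noteq> c" "i \<noteq> c'" using v by (auto simp: centers_def c_def c'_def)
      then show ?thesis using Spine c' by (auto simp: cdist_def mirror_def)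
    next
      case (Leaf i j)
      then show ?thesis using c' by (auto simp: cdist_def mirror_def)
    qed
    ultimately show "\<exists>u\<in>?V. cdist u (mirror n u) < cdist u v + cdist v (mirror n u)" by blast
  qed
  have c: "(n + 1) div 2 \<in> centers n" by (simp add: centers_def)
  show ?thesis
  proof (intro set_eqI iffI)
    fix v assume "v \<in> weight_centers (caterpillar n k)"
    then have "v \<in> ?V" "?W v \<le> ?W (Spine ((n + 1) div 2))"
      using centers_V[OF c] by (auto simp: weight_centers_def)
    then show "v \<in> Spine ` centers n" using strict[of v] eq[OF c] by fastforce
  next
    fix v assume "v \<in> Spine ` centers n"
    then show "v \<in> weight_centers (caterpillar n k)"
      using centers_V eq ge by (fastforce simp: weight_centers_def)
  qed
qed

lemma card_weight_centers:
  "n \<ge> 3 \<Longrightarrow> card (weight_centers (caterpillar n k)) = (if odd n then 1 else 2)"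
  by (simp add: weight_centers_caterpillar card_image inj_on_def card_centers)

lemma level_caterpillar:
  assumes "n \<ge> 3" and u: "u \<in> pverts (caterpillar n k)"
  shows "level (caterpillar n k) u = clevel n u"
proof -
  have V: "Spine c \<in> pverts (caterpillar n k)" if "c \<in> centers n" for c
    using that assms(1) by (auto simp: centers_def)
  have "{gdist (caterpillar n k) u x |x. x \<in> weight_centers (caterpillar n k)} =
    (\<lambda>c. cdist u (Spine c)) ` centers n"
    unfolding weight_centers_caterpillar[OF assms(1)]
    using gdist_caterpillar[OF assms(1) u V] by force
  then have "level (caterpillar n k) u =
      min (cdist u (Spine ((n + 1) div 2))) (cdist u (Spine ((n + 2) div 2)))"
    by (simp add: level_def centers_def)
  also have "\<dots> = clevel n u"
  proof -
    define c where "c = (n + 1) div 2"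
    define c' where "c' = (n + 2) div 2"
    have "c' = c \<or> c' = c + 1" unfolding c_def c'_def by linarith
    then show ?thesis unfolding clevel_def c_def[symmetric] c'_def[symmetric]
      by (cases u) (auto simp: cdist_def min_def)
  qed
  finally show ?thesis .
qed

section \<open>Values of the tree parameters\<close>

lemma eps_caterpillar: "n \<ge> 3 \<Longrightarrow> eps (caterpillar n k) = (if odd n then 1 else 0)"
  by (simp add: eps_def card_weight_centers)

text \<open>Leaves at the ends of the spine have level exactly \<open>(n + 1) div 2\<close>. Other
  leaves exist only for n >= 5; they have level 2, while the threshold is then at least 3.\<close>

lemma clevel_Leaf_ge_iff:
  assumes "n \<ge> 3" "i \<in> leaf_positions n"
  shows "clevel n (Leaf i j) \<ge> (n + 1) div 2 \<longleftrightarrow> i = 1 \<or> i = n"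
proof (cases "odd n")
  case True
  then obtain m where n: "n = 2 * m + 1" by (rule oddE)
  have "i = 1 \<or> i = m \<or> i = m + 2 \<or> i = 2 * m + 1" and "m \<ge> 1"
    using assms unfolding n leaf_positions_odd by auto
  then show ?thesis unfolding n clevel_def by (elim disjE) auto
next
  case False
  then obtain m where n: "n = 2 * m" by (auto elim: evenE)
  have "i = 1 \<or> i = m - 1 \<or> i = m + 2 \<or> i = 2 * m" and "m \<ge> 2"
    using assms unfolding n leaf_positions_even by auto
  then show ?thesis unfolding n clevel_def by (elim disjE) auto
qed

text \<open>For odd \<open>n\<close> the diameter n + 1 is even and the ceiling is exact, so both
  parities share one threshold.\<close>

lemma far_vertices_caterpillar:
  assumes "n \<ge> 3" "k \<ge> 1"
  shows "far_vertices (caterpillar n k) = {u \<in> pverts (caterpillar n k). clevel n u \<ge> (n + 1) div 2}"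
proof -
  have "\<lceil>real (n + 1) / 2\<rceil> = (n + 1) div 2" if "odd n"
  proof -
    have "real (n + 1) / 2 = real_of_int (int ((n + 1) div 2))"
      using that by (auto elim!: oddE simp: add_divide_distrib)
    then show ?thesis by (simp only: ceiling_of_int)
  qed
  moreover have "\<lfloor>real (n + 1) / 2\<rfloor> = (n + 1) div 2"
    using floor_divide_of_nat_eq[of "n + 1" 2] by simp
  ultimately show ?thesis
    unfolding far_vertices_def card_weight_centers[OF assms(1)] graph_diameter_caterpillar[OF assms]
    using level_caterpillar[OF assms(1)] by auto
qed

lemma card_far_vertices:
  assumes "n \<ge> 3" "k \<ge> 1"
  shows "card (far_vertices (caterpillar n k)) = 2 * k"
proof -
  have "far_vertices (caterpillar n k) = case_prod Leaf ` ({1, n} \<times> {1..k})"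
  proof (intro set_eqI)
    fix u
    show "u \<in> far_vertices (caterpillar n k) \<longleftrightarrow> u \<in> case_prod Leaf ` ({1, n} \<times> {1..k})"
    proof (cases u)
      case (Spine i)
      have "\<not> (n + 1) div 2 \<le> clevel n (Spine i)" if "1 \<le> i" "i \<le> n"
        using that assms(1) unfolding clevel_def by simp
      then show ?thesis using Spine by (auto simp: far_vertices_caterpillar[OF assms])
    next
      case (Leaf i j)
      have "1 \<in> leaf_positions n" "n \<in> leaf_positions n" by (auto simp: leaf_positions_def)
      then show ?thesis using Leaf clevel_Leaf_ge_iff[OF assms(1), of i j]
        by (auto simp: far_vertices_caterpillar[OF assms])
    qed
  qed
  moreover have "inj_on (case_prod Leaf) ({1, n} \<times> {1..k})" by (auto simp: inj_on_def)
  ultimately show ?thesis using assms(1) by (simp add: card_image card_cartesian_product)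
qed

lemma xi_caterpillar:
  assumes "n \<ge> 3" "k \<ge> 1"
  shows "xi (caterpillar n k) = (if odd n then int k else 2 * int k - 2)"
  using assms by (simp add: xi_def card_weight_centers card_far_vertices)

lemma sum_pverts_caterpillar:
  "(\<Sum>u\<in>pverts (caterpillar n k). g u) =
     (\<Sum>i=1..n. g (Spine i)) + (\<Sum>i\<in>leaf_positions n. \<Sum>j=1..k. g (Leaf i j))"
  for g :: "cat_vertex \<Rightarrow> nat"
proof -
  have "(\<Sum>u\<in>pverts (caterpillar n k). g u) = (\<Sum>u\<in>Spine ` {1..n}. g u) +
      (\<Sum>u\<in>case_prod Leaf ` (leaf_positions n \<times> {1..k}). g u)"
    unfolding pverts_caterpillar
    by (rule sum.union_disjoint) (auto simp: finite_leaf_positions)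
  also have "(\<Sum>u\<in>Spine ` {1..n}. g u) = (\<Sum>i=1..n. g (Spine i))"
    by (subst sum.reindex) (auto simp: inj_on_def)
  also have "(\<Sum>u\<in>case_prod Leaf ` (leaf_positions n \<times> {1..k}). g u) =
      (\<Sum>i\<in>leaf_positions n. \<Sum>j=1..k. g (Leaf i j))"
    by (subst sum.reindex) (auto simp: inj_on_def sum.cartesian_product intro!: sum.cong)
  finally show ?thesis .
qed

lemma card_pverts_caterpillar: "card (pverts (caterpillar n k)) = n + k * card (leaf_positions n)"
  using sum_pverts_caterpillar[of "\<lambda>_. 1" n k] by (simp add: mult.commute)

text \<open>The reflection turns the left half of the sum into the right half. Truncated subtraction
  makes each half a triangular number.\<close>

lemma sum_level_spine:
  "(\<Sum>i=1..n. clevel n (Spine i)) = (n - 1) div 2 * ((n - 1) div 2 + 1)"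
proof -
  have half: "2 * (\<Sum>i=1..a. i - b) = (a - b) * (a - b + 1)" for a b :: nat
  proof (induction a)
    case (Suc a)
    show ?case
    proof (cases "b \<le> a")
      case True
      then obtain e where "a = b + e" by (auto simp: le_iff_add)
      with Suc show ?thesis by (simp add: algebra_simps)
    qed (use Suc in simp)
  qed simp
  have "(\<Sum>i=1..n. (n + 1) div 2 - i) = (\<Sum>i=1..n. (n + 1) div 2 - (n + 1 - i))"
    by (subst sum.atLeastAtMost_rev) simp
  also have "\<dots> = (\<Sum>i=1..n. i - (n + 2) div 2)"
    by (rule sum.cong) auto
  finally have "(\<Sum>i=1..n. clevel n (Spine i)) = 2 * (\<Sum>i=1..n. i - (n + 2) div 2)"
    by (simp add: clevel_def sum.distrib)
  also have "\<dots> = (n - (n + 2) div 2) * (n - (n + 2) div 2 + 1)" by (rule half)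
  also have "n - (n + 2) div 2 = (n - 1) div 2" by linarith
  finally show ?thesis .
qed

text \<open>Levels do not depend on the leaf index, so the index \<open>0\<close>, which is no
  vertex, stands for all \<open>k\<close> leaves at a position.\<close>

lemma total_level_caterpillar:
  assumes "n \<ge> 3"
  shows "total_level (caterpillar n k) = (n - 1) div 2 * ((n - 1) div 2 + 1)
    + k * (\<Sum>i\<in>leaf_positions n. clevel n (Leaf i 0))"
proof -
  have "total_level (caterpillar n k) = (\<Sum>u\<in>pverts (caterpillar n k). clevel n u)"
    unfolding total_level_def using level_caterpillar[OF assms] by simp
  also have "\<dots> = (\<Sum>i=1..n. clevel n (Spine i)) + (\<Sum>i\<in>leaf_positions n. k * clevel n (Leaf i 0))"
    unfolding sum_pverts_caterpillar by (simp add: clevel_def)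
  finally show ?thesis unfolding sum_level_spine by (simp add: sum_distrib_left)
qed

section \<open>The lower bound for caterpillars\<close>

definition level_bound :: "'a pair_pre_digraph \<Rightarrow> int" where
  "level_bound T = (int (card (pverts T)) - 1) * (int (graph_diameter T) + eps T)
     - 2 * int (total_level T) + eps T + xi T"

lemma radio_labelling_caterpillar_lower_bound:
  assumes "n \<ge> 3" "k \<ge> 1" and f: "radio_labelling (caterpillar n k) f"
  shows "\<exists>x\<in>pverts (caterpillar n k). \<exists>y\<in>pverts (caterpillar n k).
    level_bound (caterpillar n k) \<le> int (f y) - int (f x)"
proof -
  let ?T = "caterpillar n k" and ?V = "pverts (caterpillar n k)"
  define w :: int where "w = (if odd n then 1 else 2)"
  define h where "h = int ((n + 1) div 2)"
  define L where "L u = int (clevel n u)" for u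
  define D where "D u v = int (cdist u v)" for u v
  define side where "side u \<longleftrightarrow> pos u \<le> n div 2" for u
  define c where "c = (n + 1) div 2"
  define c' where "c' = (n + 2) div 2"
  have nw: "int n + 1 = 2 * h + w - 1"
    unfolding h_def w_def by (auto elim!: oddE evenE)
  have cw: "int c' = int c + w - 1"
    unfolding c_def c'_def w_def by (auto elim!: oddE evenE)
  have L_alt: "clevel n u = height u + (c - pos u) + (pos u - c')" for u
    by (simp add: clevel_def c_def c'_def)
  have centers: "centers n = {c, c'}" by (simp add: centers_def c_def c'_def)
  have L0: "{v \<in> ?V. L v = 0} = Spine ` centers n"
  proof (intro set_eqI)
    fix v
    show "v \<in> {v \<in> ?V. L v = 0} \<longleftrightarrow> v \<in> Spine ` centers n"
    proof (cases v)
      case (Spine i)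
      have "c' = c \<or> c' = c + 1" using cw by (auto simp: w_def split: if_splits)
      then have "(c - i) + (i - c') = 0 \<longleftrightarrow> i = c \<or> i = c'" by auto
      moreover have "1 \<le> c" "c \<le> n" "c' \<le> n" using assms(1) unfolding c_def c'_def by linarith+
      ultimately show ?thesis
        unfolding Spine centers L_def L_alt by auto
    qed (auto simp: L_def clevel_def)
  qed
  obtain x y where xy: "x \<in> ?V" "y \<in> ?V"
    "2 * (int (f y) - int (f x)) \<ge> 2 * (int (card ?V) - 1) * (2 * h + 1) - 4 * (\<Sum>v\<in>?V. L v)
       + w * (int (card {v \<in> ?V. L v \<ge> h}) - 2 * w) + 2 + w"
  proof (rule radio_span_lower_bound[where V = ?V and w = w and L = L and h = h
        and d = "int n + 1" and f = f and D = D and side = side])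
    show "finite ?V" by (rule finite_pverts_caterpillar)
    show "card ?V \<ge> 2" using assms by (simp add: card_pverts_caterpillar)
    show "w = int (card {v \<in> ?V. L v = 0})"
      unfolding L0 by (simp add: card_image inj_on_def card_centers w_def)
    show "w \<in> {1, 2}" by (simp add: w_def)
    show "h \<ge> 2" using assms(1) by (simp add: h_def)
    show "int n + 1 = 2 * h + w - 1" by (rule nw)
    show "L u \<ge> 0" for u by (simp add: L_def)
  next
    fix u v assume uv: "u \<in> ?V" "v \<in> ?V" "u \<noteq> v"
    have "\<bar>int (f u) - int (f v)\<bar> \<ge> int (graph_diameter ?T) + 1 - int (gdist ?T u v)"
      using f uv by (simp add: radio_labelling_def)
    then show "\<bar>int (f u) - int (f v)\<bar> \<ge> int n + 1 + 1 - D u v"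
      using graph_diameter_caterpillar[OF assms(1,2)] gdist_caterpillar[OF assms(1) uv(1,2)]
      by (simp add: D_def)
    have range: "1 \<le> pos u" "pos u \<le> n" "1 \<le> pos v" "pos v \<le> n" "height u \<le> 1" "height v \<le> 1"
      using pos_in_range[OF assms(1) uv(1)] pos_in_range[OF assms(1) uv(2)]
      by (cases u; cases v; simp)+
    have D: "D u v = \<bar>int (pos u) - int (pos v)\<bar> + height u + height v"
      using uv(3) by (auto simp: D_def cdist_def)
    have L: "L a \<ge> height a" "L a \<ge> height a + (int c - pos a)" "L a \<ge> height a + (int (pos a) - c')" for a
      unfolding L_def L_alt by linarith+
    show "D u v \<le> min (int n + 1) (L u + L v + w - 1)"
      using range D L[of u] L[of v] cw by (auto simp: w_def split: if_splits)
    assume pos: "L u > 0" "L v > 0" and side: "side u = side v"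
    \<comment> \<open>Off the centers both positions are at least 1 away from the nearest center on
      their side; the term -2 below is this shared edge counted twice.\<close>
    have noncenter: "pos a < c \<or> c' < pos a" if "a \<in> ?V" "L a > 0" for a
    proof (cases a)
      case (Spine i)
      then show ?thesis using that by (auto simp: L_def L_alt)
    next
      case (Leaf i j)
      then show ?thesis using that center_not_leaf_position[OF assms(1), of i]
        by (simp add: c_def c'_def)
    qed
    have "pos a < c \<longleftrightarrow> side a" if "pos a < c \<or> c' < pos a" for a
      using that unfolding side_def c_def c'_def by linarith
    then have "pos u < c \<and> pos v < c \<or> c' < pos u \<and> c' < pos v"
      using noncenter[OF uv(1) pos(1)] noncenter[OF uv(2) pos(2)] side by blast
    then show "D u v \<le> L u + L v - 2"
      using D L[of u] L[of v] by auto
  qed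
  have far: "{v \<in> ?V. L v \<ge> h} = far_vertices ?T"
    unfolding far_vertices_caterpillar[OF assms(1,2)] L_def h_def by auto
  have tot: "(\<Sum>v\<in>?V. L v) = int (total_level ?T)"
    unfolding total_level_def L_def using level_caterpillar[OF assms(1)] by simp
  have he: "2 * h + 1 = int (graph_diameter ?T) + eps ?T"
    using nw by (simp add: graph_diameter_caterpillar[OF assms(1,2)] eps_caterpillar[OF assms(1)] w_def
        split: if_splits)
  define P where "P = (int (card ?V) - 1) * (2 * h + 1)"
  have "2 * (int (f y) - int (f x)) \<ge>
      2 * P - 4 * int (total_level ?T) + w * (2 * int k - 2 * w) + 2 + w"
    using xy(3) unfolding far tot card_far_vertices[OF assms(1,2)] P_def
    by (simp only: mult.assoc of_nat_mult of_nat_numeral)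
  \<comment> \<open>For odd \<open>n\<close> the doubled bound ends in 2k + 1; integrality rounds it
    up to k + 1, which is \<open>xi\<close> plus \<open>eps\<close>. For even \<open>n\<close> it is
    exact.\<close>
  then have "level_bound ?T \<le> int (f y) - int (f x)"
    unfolding level_bound_def xi_caterpillar[OF assms(1,2)] he[symmetric] P_def[symmetric]
    by (auto simp: w_def eps_caterpillar[OF assms(1)] split: if_splits)
  then show ?thesis using xy by blast
qed

lemma radio_number_caterpillar_eqI:
  assumes "n \<ge> 3" "k \<ge> 1"
    and set: "fst ` set xs = pverts (caterpillar n k)"
    and len: "length xs = card (pverts (caterpillar n k))"
    and "admissible cdist (n + 1) xs"
    and "int (sum_list (map snd (butlast xs))) = level_bound (caterpillar n k)"
  shows "int (radio_number (caterpillar n k)) = level_bound (caterpillar n k)"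
proof -
  \<comment> \<open>No pairwise comparison is needed: the length equals the number of vertices
    covered.\<close>
  have "distinct (map fst xs)"
    using set len by (intro card_distinct) simp
  moreover have "cdist u v \<ge> 1" if "u \<noteq> v" for u v
    using that by (cases u; cases v) (auto simp: cdist_def)
  ultimately have "radio_labelling (caterpillar n k) (list_label xs)"
    using admissible_radio[OF assms(5)] gdist_caterpillar[OF assms(1)]
      graph_diameter_caterpillar[OF assms(1,2)]
    by (auto simp: radio_labelling_def set cdist_commute)
  then have "radio_number (caterpillar n k) = sum_list (map snd (butlast xs))"
    using radio_labelling_caterpillar_lower_bound[OF assms(1,2)] list_label_le[of _ xs] assms(6) set
    by (intro radio_number_eqI[of _ _ "list_label xs"]) (auto simp: finite_pverts_caterpillar)
  then show ?thesis using assms(6) by simp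
qed

section \<open>Optimal labellings\<close>

lemma cdist_simps [simp]:
  "cdist (Spine i) (Leaf i' j') = (i - i') + (i' - i) + 1"
  "cdist (Leaf i j) (Spine i') = (i - i') + (i' - i) + 1"
  "cdist (Leaf i j) (Leaf i' j') = (if i = i' \<and> j = j' then 0 else (i - i') + (i' - i) + 2)"
  by (auto simp: cdist_def)

text \<open>
  Below, $c$ is a center, $a_i, b_i$ are the spine vertices of level $i$ to its left and right,
  $x_j, y_j$ the far leaves and $s_j, t_j$ the leaves of level 2 attached to $a_1, b_1$, left and
  right. For $n = 3$ the order of the vertices is
  $c, x_k, y_k, \ldots, x_1, y_1, a_1, b_1$.
\<close>

fun labels3 :: "nat \<Rightarrow> (cat_vertex \<times> nat) list" where
  "labels3 0 = [(Spine 1, 3), (Spine 3, 4)]"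
| "labels3 (Suc j) = (Leaf 1 (Suc j), 1) # (Leaf 3 (Suc j), if j = 0 then 3 else 2) # labels3 j"

text \<open>The gap after \<open>y_j\<close> is governed by \<open>x_j\<close> and the entry after
  \<open>y_j\<close>, which lie on one side at distance 2, or 1 for \<open>a_1\<close>; hence 2 and
  3. The second case distinction is there because \<open>admissible\<close> looks three entries
  ahead.\<close>

lemma admissible_labels3: "admissible cdist 4 (labels3 j)"
proof (induction j)
  case (Suc j)
  then show ?case by (cases j) auto
qed simp

lemma set_labels3:
  "fst ` set (labels3 j) = {Spine 1, Spine 3} \<union> case_prod Leaf ` ({1, 3} \<times> {1..j})"
  by (induction j) (auto simp: atLeastAtMostSuc_conv)

lemma length_labels3: "length (labels3 j) = 2 * j + 2"
  by (induction j) auto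

text \<open>Lets \<open>butlast\<close> be evaluated when the tail of the list is still
  symbolic.\<close>

lemma labels3_not_Nil [simp]: "labels3 j \<noteq> []"
  by (cases j) auto

lemma sum_labels3: "sum_list (map snd (butlast (labels3 (Suc j)))) = 3 * j + 7"
  by (induction j) auto

text \<open>
  For $n = 4$, with centers $a_0, b_0$, the order is
  $a_0, y_{k-1}, x_{k-1}, \ldots, y_1, x_1, y_k, a_1, b_1, x_k, b_0$.
\<close>

fun labels4 :: "nat \<Rightarrow> nat \<Rightarrow> (cat_vertex \<times> nat) list" where
  "labels4 k 0 = [(Leaf 4 k, 2), (Spine 1, 3), (Spine 4, 2), (Leaf 1 k, 3), (Spine 3, 5)]"
| "labels4 k (Suc j) = (Leaf 4 (Suc j), 1) # (Leaf 1 (Suc j), 3) # labels4 k j"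

text \<open>\<open>j < k\<close> keeps \<open>Leaf 4 k\<close> different from
  \<open>Leaf 4 1\<close> two places before it; the gaps 1 and 3 rely on their distance being 2
  rather than 0.\<close>

lemma admissible_labels4: "j < k \<Longrightarrow> admissible cdist 5 (labels4 k j)"
proof (induction j)
  case (Suc j)
  then show ?case by (cases j) auto
qed simp

lemma set_labels4:
  "fst ` set (labels4 k j) = {Spine 1, Spine 3, Spine 4} \<union> case_prod Leaf ` ({1, 4} \<times> insert k {1..j})"
  by (induction j) (auto simp: atLeastAtMostSuc_conv)

lemma length_labels4: "length (labels4 k j) = 2 * j + 5"
  by (induction j) auto

lemma labels4_not_Nil [simp]: "labels4 k j \<noteq> []"
  by (cases j) auto

lemma sum_labels4: "sum_list (map snd (butlast (labels4 k j))) = 4 * j + 10"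
  by (induction j) auto

text \<open>
  For $n = 2m + 1$ with $m = q + 2$ the order is
  $c, a_m, b_m, a_1$, then the blocks $t_j, x_j, y_j, s_j$ for $j = k, \ldots, 1$, then
  $b_{m-1}, a_2, b_{m-2}, \ldots, a_{m-1}, b_1$. All gaps meet the bound $2m + 3 - L(u) - L(v)$
  with equality, except for one unit more between $x_j$ and $y_j$.
\<close>

fun odd_spine_labels :: "nat \<Rightarrow> nat \<Rightarrow> (cat_vertex \<times> nat) list" where
  "odd_spine_labels q 0 = [(Spine (q + 4), 2 * q + 6)]"
| "odd_spine_labels q (Suc a) =
     (Spine (q + a + 5), q + 4) # (Spine (a + 2), q + 5) # odd_spine_labels q a"

fun odd_labels :: "nat \<Rightarrow> nat \<Rightarrow> (cat_vertex \<times> nat) list" where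
  "odd_labels q 0 = odd_spine_labels q q"
| "odd_labels q (Suc j) =
     (Leaf (q + 4) (Suc j), q + 2) # (Leaf 1 (Suc j), 2) # (Leaf (2 * q + 5) (Suc j), q + 2) #
     (Leaf (q + 2) (Suc j), if j = 0 then q + 4 else 2 * q + 3) # odd_labels q j"

lemma admissible_odd_spine_labels:
  "a \<le> q \<Longrightarrow> admissible cdist (2 * q + 6) (odd_spine_labels q a)"
proof (induction a)
  case (Suc a)
  then show ?case by (cases a) auto
qed simp

text \<open>The levels alone ask for a gap of 1 between \<open>x_j\<close> and \<open>y_j\<close>.
  But \<open>t_j\<close> and \<open>y_j\<close> are at distance q + 3 on one side, and so are
  \<open>x_j\<close> and \<open>s_j\<close>; next to the gaps q + 2 both pairs require the same
  2.\<close>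

lemma admissible_odd_labels: "admissible cdist (2 * q + 6) (odd_labels q j)"
proof (induction j)
  case 0
  show ?case by (simp add: admissible_odd_spine_labels)
next
  case (Suc j)
  show ?case
  proof (cases j)
    case 0
    then show ?thesis using admissible_odd_spine_labels[of q q] by (cases q) auto
  next
    case (Suc i)
    then show ?thesis using \<open>admissible cdist (2 * q + 6) (odd_labels q j)\<close> by simp
  qed
qed

lemma set_odd_spine_labels:
  "fst ` set (odd_spine_labels q a) = Spine ` ({2..a + 1} \<union> {q + 4..q + a + 4})"
  by (induction a) (auto simp: atLeastAtMostSuc_conv)

lemma set_odd_labels:
  "fst ` set (odd_labels q j) = Spine ` ({2..q + 1} \<union> {q + 4..2 * q + 4}) \<union>
     case_prod Leaf ` ({1, q + 2, q + 4, 2 * q + 5} \<times> {1..j})"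
  by (induction j) (auto simp: atLeastAtMostSuc_conv set_odd_spine_labels)

lemma length_odd_spine_labels: "length (odd_spine_labels q a) = 2 * a + 1"
  by (induction a) auto

lemma length_odd_labels: "length (odd_labels q j) = 4 * j + 2 * q + 1"
  by (induction j) (auto simp: length_odd_spine_labels)

lemma odd_labels_not_Nil [simp]: "odd_spine_labels q a \<noteq> []" "odd_labels q j \<noteq> []"
proof -
  show "odd_spine_labels q a \<noteq> []" for a by (cases a) auto
  then show "odd_labels q j \<noteq> []" by (cases j) auto
qed

lemma sum_odd_spine_labels:
  "sum_list (map snd (butlast (odd_spine_labels q a))) = a * (2 * q + 9)"
  by (induction a) auto

text \<open>Stated for \<open>Suc j\<close> because the last block leaves towards the spine with gap
  q + 4, so it contributes 3q + 10 where every other block contributes 4q + 9.\<close>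

lemma sum_odd_labels:
  "sum_list (map snd (butlast (odd_labels q (Suc j)))) =
     q * (2 * q + 9) + 3 * q + 10 + j * (4 * q + 9)"
  by (induction j) (auto simp: sum_odd_spine_labels)

text \<open>
  For $n = 2m$ with $m = q + 3$ the order is $a_0, y_k, a_1$, then the blocks
  $t_j, x_j, y_j, s_j$ for $j = k - 1, \ldots, 1$, then $t_k, s_k$, then
  $b_{m-1}, a_2, b_{m-2}, \ldots, a_{m-1}, b_1, x_k, b_0$. All gaps meet the bound
  $2m + 1 - L(u) - L(v)$ with equality, except for two units more between $x_j$ and $y_j$.
\<close>

fun even_spine_labels :: "nat \<Rightarrow> nat \<Rightarrow> nat \<Rightarrow> (cat_vertex \<times> nat) list" where
  "even_spine_labels q k 0 = [(Spine (q + 5), q + 3), (Leaf 1 k, q + 4), (Spine (q + 4), 2 * q + 7)]"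
| "even_spine_labels q k (Suc a) =
     (Spine (q + a + 6), q + 3) # (Spine (a + 1), q + 4) # even_spine_labels q k a"

fun even_labels :: "nat \<Rightarrow> nat \<Rightarrow> nat \<Rightarrow> (cat_vertex \<times> nat) list" where
  "even_labels q k 0 =
     (Leaf (q + 5) k, 2 * q + 3) # (Leaf (q + 2) k, q + 3) # even_spine_labels q k (q + 1)"
| "even_labels q k (Suc j) =
     (Leaf (q + 5) (Suc j), q + 2) # (Leaf 1 (Suc j), 3) # (Leaf (2 * q + 6) (Suc j), q + 2) #
     (Leaf (q + 2) (Suc j), 2 * q + 3) # even_labels q k j"

lemma admissible_even_spine_labels:
  "a \<le> q + 1 \<Longrightarrow> admissible cdist (2 * q + 7) (even_spine_labels q k a)"
proof (induction a)
  case (Suc a)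
  then show ?case by (cases a) auto
qed simp

text \<open>\<open>x_k\<close> and \<open>y_k\<close> are used beside the centers, so
  \<open>t_k, s_k\<close> form a block without far leaves. \<open>j < k\<close> separates
  \<open>s_k\<close> from \<open>s_1\<close>, two places before it; for q = 0 their distance 2 is
  indispensable.\<close>

lemma admissible_even_labels:
  assumes "j < k"
  shows "admissible cdist (2 * q + 7) (even_labels q k j)"
  using assms
proof (induction j)
  case 0
  show ?case using admissible_even_spine_labels[of "q + 1" q k] by simp
next
  case (Suc j)
  then show ?case by (cases j) auto
qed

lemma set_even_spine_labels:
  "fst ` set (even_spine_labels q k a) = insert (Leaf 1 k) (Spine ` ({1..a} \<union> {q + 4..q + a + 5}))"
  by (induction a) (auto simp: atLeastAtMostSuc_conv)

lemma set_even_labels: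
  "fst ` set (even_labels q k j) = Spine ` ({1..q + 1} \<union> {q + 4..2 * q + 6}) \<union>
     {Leaf 1 k, Leaf (q + 2) k, Leaf (q + 5) k} \<union>
     case_prod Leaf ` ({1, q + 2, q + 5, 2 * q + 6} \<times> {1..j})"
proof (induction j)
  case 0
  have "q + (q + 1) + 5 = 2 * q + 6" by simp
  then show ?case
    by (simp only: even_labels.simps list.set image_insert set_even_spine_labels) auto
qed (auto simp: atLeastAtMostSuc_conv)

lemma length_even_spine_labels: "length (even_spine_labels q k a) = 2 * a + 3"
  by (induction a) auto

lemma length_even_labels: "length (even_labels q k j) = 4 * j + 2 * q + 7"
  by (induction j) (auto simp: length_even_spine_labels)

lemma even_labels_not_Nil [simp]: "even_spine_labels q k a \<noteq> []" "even_labels q k j \<noteq> []"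
proof -
  show "even_spine_labels q k a \<noteq> []" for a by (cases a) auto
  then show "even_labels q k j \<noteq> []" by (cases j) auto
qed

lemma sum_even_spine_labels:
  "sum_list (map snd (butlast (even_spine_labels q k a))) = (a + 1) * (2 * q + 7)"
  by (induction a) auto

lemma sum_even_labels:
  "sum_list (map snd (butlast (even_labels q k j))) =
     (q + 2) * (2 * q + 7) + 3 * q + 6 + j * (4 * q + 10)"
  by (induction j) (auto simp: sum_even_spine_labels)

section \<open>Closed forms of the bound\<close>

lemma leaf_positions_odd_shifted: "leaf_positions (2 * q + 5) = {1, q + 2, q + 4, 2 * q + 5}"
proof -
  have "2 * q + 5 = 2 * (q + 2) + 1" by simp
  then show ?thesis by (simp only: leaf_positions_odd) auto
qed

lemma leaf_positions_even_shifted: "leaf_positions (2 * q + 6) = {1, q + 2, q + 5, 2 * q + 6}"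
proof -
  have "2 * q + 6 = 2 * (q + 3)" by simp
  then show ?thesis by (simp only: leaf_positions_even) auto
qed

lemma level_bound_odd:
  assumes "k \<ge> 1"
  shows "level_bound (caterpillar (2 * q + 5) k) =
    2 * (int q)\<^sup>2 + 12 * int q + 17 + (4 * int q + 9) * int k"
proof -
  have n: "(2 * q + 5::nat) \<ge> 3" by simp
  \<comment> \<open>Two positions of level q + 3 at the ends and two of level 2 near the
    center.\<close>
  have "(\<Sum>i\<in>leaf_positions (2 * q + 5). clevel (2 * q + 5) (Leaf i 0)) = 2 * q + 10"
    unfolding leaf_positions_odd_shifted by (simp add: clevel_def)
  then show ?thesis
    unfolding level_bound_def graph_diameter_caterpillar[OF n assms] eps_caterpillar[OF n]
      xi_caterpillar[OF n assms] total_level_caterpillar[OF n] card_pverts_caterpillar leaf_positions_odd_shifted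
    by (simp add: algebra_simps power2_eq_square)
qed

lemma level_bound_even:
  assumes "k \<ge> 1"
  shows "level_bound (caterpillar (2 * q + 6) k) =
    2 * (int q)\<^sup>2 + 14 * int q + 21 + (4 * int q + 10) * int k"
proof -
  have n: "(2 * q + 6::nat) \<ge> 3" by simp
  have "(\<Sum>i\<in>leaf_positions (2 * q + 6). clevel (2 * q + 6) (Leaf i 0)) = 2 * q + 10"
    unfolding leaf_positions_even_shifted by (simp add: clevel_def)
  then show ?thesis
    unfolding level_bound_def graph_diameter_caterpillar[OF n assms] eps_caterpillar[OF n]
      xi_caterpillar[OF n assms] total_level_caterpillar[OF n] card_pverts_caterpillar leaf_positions_even_shifted
    by (simp add: algebra_simps power2_eq_square)
qed

lemma level_bound_3: "k \<ge> 1 \<Longrightarrow> level_bound (caterpillar 3 k) = 3 * int k + 7"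
  by (simp add: level_bound_def graph_diameter_caterpillar eps_caterpillar xi_caterpillar
      total_level_caterpillar card_pverts_caterpillar leaf_positions_def clevel_def algebra_simps)

lemma level_bound_4: "k \<ge> 1 \<Longrightarrow> level_bound (caterpillar 4 k) = 4 * int k + 9"
  by (simp add: level_bound_def graph_diameter_caterpillar eps_caterpillar xi_caterpillar
      total_level_caterpillar card_pverts_caterpillar leaf_positions_def clevel_def algebra_simps)

section \<open>Optimality of the four families of labellings\<close>

lemma radio_number_3:
  assumes "k \<ge> 1"
  shows "int (radio_number (caterpillar 3 k)) = level_bound (caterpillar 3 k)"
proof -
  obtain j where k: "k = Suc j" using assms by (cases k) auto
  define xs where "xs = (Spine 2, 3) # labels3 k"
  show ?thesis
  proof (rule radio_number_caterpillar_eqI[where xs = xs])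
    have "{1..3} = {1, 2, 3::nat}" by auto
    then show "fst ` set xs = pverts (caterpillar 3 k)"
      by (auto simp: xs_def set_labels3 pverts_caterpillar leaf_positions_def)
    show "length xs = card (pverts (caterpillar 3 k))"
      by (simp add: xs_def length_labels3 card_pverts_caterpillar leaf_positions_def)
    show "admissible cdist (3 + 1) xs"
      using admissible_labels3[of k] by (cases j) (auto simp: xs_def k)
    show "int (sum_list (map snd (butlast xs))) = level_bound (caterpillar 3 k)"
      unfolding level_bound_3[OF assms] by (simp add: xs_def k sum_labels3 del: labels3.simps)
  qed (use assms in auto)
qed

lemma radio_number_4:
  assumes "k \<ge> 1"
  shows "int (radio_number (caterpillar 4 k)) = level_bound (caterpillar 4 k)"
proof -
  obtain j where k: "k = Suc j" using assms by (cases k) auto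
  define xs where "xs = (Spine 2, 3) # labels4 k j"
  show ?thesis
  proof (rule radio_number_caterpillar_eqI[where xs = xs])
    have "{1..4} = {1, 2, 3, 4::nat}" "insert k {1..j} = {1..k}" by (auto simp: k)
    then show "fst ` set xs = pverts (caterpillar 4 k)"
      by (auto simp: xs_def set_labels4 pverts_caterpillar leaf_positions_def)
    show "length xs = card (pverts (caterpillar 4 k))"
      by (simp add: xs_def length_labels4 card_pverts_caterpillar leaf_positions_def k)
    show "admissible cdist (4 + 1) xs"
      using admissible_labels4[of j k] by (cases j) (auto simp: xs_def k)
    show "int (sum_list (map snd (butlast xs))) = level_bound (caterpillar 4 k)"
      unfolding level_bound_4[OF assms] by (simp add: xs_def k sum_labels4)
  qed (use assms in auto)
qed

lemma radio_number_odd: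
  assumes "k \<ge> 1"
  shows "int (radio_number (caterpillar (2 * q + 5) k)) = level_bound (caterpillar (2 * q + 5) k)"
proof -
  obtain j where k: "k = Suc j" using assms by (cases k) auto
  define xs where "xs = (Spine (q + 3), q + 5) # (Spine 1, 3) # (Spine (2 * q + 5), q + 4) #
    (Spine (q + 2), 2 * q + 4) # odd_labels q k"
  show ?thesis
  proof (rule radio_number_caterpillar_eqI[where xs = xs])
    have "{1..2 * q + 5} = {q + 3, 1, 2 * q + 5, q + 2} \<union> ({2..q + 1} \<union> {q + 4..2 * q + 4})"
      by auto
    then show "fst ` set xs = pverts (caterpillar (2 * q + 5) k)"
      unfolding pverts_caterpillar leaf_positions_odd_shifted by (simp add: xs_def set_odd_labels image_Un Un_assoc)
    show "length xs = card (pverts (caterpillar (2 * q + 5) k))"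
      by (simp add: xs_def length_odd_labels card_pverts_caterpillar leaf_positions_odd_shifted)
    have diam: "2 * q + 5 + 1 = 2 * q + 6" by simp
    show "admissible cdist (2 * q + 5 + 1) xs"
      unfolding diam using admissible_odd_labels[of q k] by (auto simp: xs_def k)
    show "int (sum_list (map snd (butlast xs))) = level_bound (caterpillar (2 * q + 5) k)"
      unfolding level_bound_odd[OF assms]
      by (simp add: xs_def k sum_odd_labels algebra_simps power2_eq_square del: odd_labels.simps)
  qed (use assms in auto)
qed

lemma radio_number_even:
  assumes "k \<ge> 1"
  shows "int (radio_number (caterpillar (2 * q + 6) k)) = level_bound (caterpillar (2 * q + 6) k)"
proof -
  obtain j where k: "k = Suc j" using assms by (cases k) auto
  define xs where "xs = (Spine (q + 3), q + 4) # (Leaf (2 * q + 6) k, q + 3) #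
    (Spine (q + 2), 2 * q + 4) # even_labels q k j"
  show ?thesis
  proof (rule radio_number_caterpillar_eqI[where xs = xs])
    have "{1..2 * q + 6} = {q + 3, q + 2} \<union> ({1..q + 1} \<union> {q + 4..2 * q + 6})" by auto
    moreover have "{1..k} = insert k {1..j}" by (auto simp: k)
    ultimately show "fst ` set xs = pverts (caterpillar (2 * q + 6) k)"
      unfolding pverts_caterpillar leaf_positions_even_shifted by (simp add: xs_def set_even_labels image_Un) blast
    show "length xs = card (pverts (caterpillar (2 * q + 6) k))"
      by (simp add: xs_def length_even_labels card_pverts_caterpillar leaf_positions_even_shifted k)
    have diam: "2 * q + 6 + 1 = 2 * q + 7" by simp
    show "admissible cdist (2 * q + 6 + 1) xs"
      unfolding diam using admissible_even_labels[of j k q] by (cases j) (auto simp: xs_def k)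
    show "int (sum_list (map snd (butlast xs))) = level_bound (caterpillar (2 * q + 6) k)"
      unfolding level_bound_even[OF assms]
      by (simp add: xs_def k sum_even_labels algebra_simps power2_eq_square)
  qed (use assms in auto)
qed

theorem theorem3p3:
  fixes n k :: nat
  assumes "n \<ge> 3" and "k \<ge> 1"
  shows "real (radio_number (caterpillar n k)) =
           (if n = 3 then 3 * real k + 7
            else if n = 4 then 4 * real k + 9
            else if odd n then
              1/2 * ((real n)^2 + 4 * real n * real k + 2 * real n - 2 * real k - 1)
            else
              1/2 * ((real n)^2 + 4 * real n * real k + 2 * real n - 4 * real k - 6)) \<and>
         (let T = caterpillar n k; p = int (card (pverts T)); d = int (graph_diameter T) in
           int (radio_number T) =
             (p - 1) * (d + eps T) - 2 * int (total_level T) + eps T + xi T)"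
proof -
  let ?T = "caterpillar n k" and ?r = "radio_number (caterpillar n k)"
  consider (3) "n = 3" | (4) "n = 4" | (odd) q where "n = 2 * q + 5" | (even) q where "n = 2 * q + 6"
  proof (cases "odd n")
    case True
    then obtain m where "n = 2 * m + 1" by (rule oddE)
    then have "n = 3 \<or> n = 2 * (m - 2) + 5" using assms(1) by linarith
    then show thesis using 3 odd by blast
  next
    case False
    then obtain m where "n = 2 * m" by (auto elim: evenE)
    then have "n = 4 \<or> n = 2 * (m - 3) + 6" using assms(1) by presburger
    then show thesis using 4 even by blast
  qed
  then have "int ?r = level_bound ?T \<and> real ?r =
           (if n = 3 then 3 * real k + 7
            else if n = 4 then 4 * real k + 9
            else if odd n then
              1/2 * ((real n)^2 + 4 * real n * real k + 2 * real n - 2 * real k - 1)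
            else
              1/2 * ((real n)^2 + 4 * real n * real k + 2 * real n - 4 * real k - 6))"
  proof cases
    case 3
    have eq: "int ?r = level_bound ?T" unfolding 3 by (rule radio_number_3[OF assms(2)])
    then have "real ?r = real_of_int (3 * int k + 7)"
      unfolding 3 level_bound_3[OF assms(2)] by linarith
    then show ?thesis using eq 3 by simp
  next
    case 4
    have eq: "int ?r = level_bound ?T" unfolding 4 by (rule radio_number_4[OF assms(2)])
    then have "real ?r = real_of_int (4 * int k + 9)"
      unfolding 4 level_bound_4[OF assms(2)] by linarith
    then show ?thesis using eq 4 by simp
  next
    case (odd q)
    have eq: "int ?r = level_bound ?T" unfolding odd by (rule radio_number_odd[OF assms(2)])
    then have "real ?r = real_of_int (2 * (int q)\<^sup>2 + 12 * int q + 17 + (4 * int q + 9) * int k)"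
      unfolding odd level_bound_odd[OF assms(2)] by (metis of_int_of_nat_eq)
    then show ?thesis using eq odd by (simp add: algebra_simps power2_eq_square)
  next
    case (even q)
    have eq: "int ?r = level_bound ?T" unfolding even by (rule radio_number_even[OF assms(2)])
    then have "real ?r = real_of_int (2 * (int q)\<^sup>2 + 14 * int q + 21 + (4 * int q + 10) * int k)"
      unfolding even level_bound_even[OF assms(2)] by (metis of_int_of_nat_eq)
    then show ?thesis using eq even by (simp add: algebra_simps power2_eq_square)
  qed
  then show ?thesis by (simp add: level_bound_def Let_def)
qed

end
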